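(* Let $T$ be a finite tree. If $T$ has a $(\gamma_t-\tau)$-set, then $T\in\mathcal{T}$, where $\mathcal{T}$ is the family of trees constructed from the path $P_4$ by the operations $\mathcal{O}_1,\mathcal{O}_2,\mathcal{O}_3,\mathcal{O}_4$ defined in the context.
   Context: All graphs are finite, undirected, simple and connected. $N(v)$ is the set of neighbors of $v$ (so $v\notin N(v)$). $P_n$ is the path with $n$ vertices. An end vertex (leaf) is a vertex of degree 1; a support vertex is a neighbor of an end vertex. A vertex cover of $G=(V,E)$ is a set $X\subseteq V$ such that each edge is incident to at least one vertex of $X$; $\tau(G)$ is the minimum cardinality of a vertex cover, and a $\tau(G)$-set is a vertex cover of cardinality $\tau(G)$. A total dominating set of $G$ is a dominating set $D\subseteq V$ such that the subgraph induced by $D$ has no isolated vertices (equivalently, every vertex of $G$ has a neighbor in $D$); $\gamma_t(G)$ is the minimum cardinality of a total dominating set (defined for graphs without isolated vertices), and a $\gamma_t(G)$-set is a total dominating set of cardinality $\gamma_t(G)$. A $(\gamma_t-\tau)$-set of $G$ is a set that is both a $\gamma_t(G)$-set and a $\tau(G)$-set. For $S\subseteq V$ and $v\in S$, $\mathrm{pn}(v,S)=\{u\in V : N(u)\cap S=\{v\}\}$. For a $\gamma_t(G)$-set $S$, a vertex $v$ is $S$-quasi-isolated if there is $u\in S$ with $\mathrm{pn}(u,S)=\{v\}$; $v$ is quasi-isolated (in $G$) if it is $S$-quasi-isolated for some $\gamma_t(G)$-set $S$. For disjoint graphs $G,H$ with $u\in V(G)$, $v\in V(H)$, the sum of $G$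 with $H$ via the edge $uv$, $G+_{uv}H$, has vertex set $V(G)\cup V(H)$ and edge set $E(G)\cup E(H)\cup\{uv\}$. Operations on a tree $T$: - $\mathcal{O}_1$: choose $u\in V(T)$ belonging to some $(\gamma_t-\tau)$-set of $T$; let $v$ be a leaf of a (disjoint) path $P_4$; form $T+_{uv}P_4$. - $\mathcal{O}_2$: choose $u\in V(T)$ belonging to some $(\gamma_t-\tau)$-set of $T$; add a new vertex $v$ adjacent exactly to $u$. - $\mathcal{O}_3$: choose $u\in V(T)$ belonging to some $(\gamma_t-\tau)$-set of $T$ and such that $u$ is not quasi-isolated in $T$; let $P_2=(v,w)$ be a (disjoint) path with two vertices; form $T+_{uv}P_2$. - $\mathcal{O}_4$: choose $u\in V(T)$ that is not quasi-isolated in $T$; let $v$ be a support vertex of a (disjoint) path $P_4$; form $T+_{uv}P_4$. The family $\mathcal{T}$ consists of all trees $T$ (up to isomorphism) for which there is a sequence $T_1,\dots,T_k$ ($k\ge 1$) of trees such that $T_1=P_4$, $T_k=T$, and, if $k\ge 2$, each $T_{i+1}$ is obtained from $T_i$ by one of the operations $\mathcal{O}_1,\mathcal{O}_2,\mathcal{O}_3,\mathcal{O}_4$. *)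

theory Defs
  imports Main
begin

text \<open>A graph is a pair of a vertex set and a set of edges, an edge being a two-element
  set of vertices.\<close>

type_synonym 'a graph = "'a set \<times> 'a set set"

abbreviation verts :: "'a graph \<Rightarrow> 'a set" where
  "verts G \<equiv> fst G"

abbreviation edges :: "'a graph \<Rightarrow> 'a set set" where
  "edges G \<equiv> snd G"

definition simple_graph :: "'a graph \<Rightarrow> bool" where
  "simple_graph G \<longleftrightarrow> finite (verts G) \<and> edges G \<subseteq> {{u, v} | u v. u \<in> verts G \<and> v \<in> verts G \<and> u \<noteq> v}"

definition nbrs :: "'a graph \<Rightarrow> 'a \<Rightarrow> 'a set" where
  "nbrs G v = {u. {v, u} \<in> edges G}"

definition connected_graph :: "'a graph \<Rightarrow> bool" where
  "connected_graph G \<longleftrightarrow>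
     verts G \<noteq> {} \<and> (\<forall>u\<in>verts G. \<forall>v\<in>verts G. (u, v) \<in> {(x, y). {x, y} \<in> edges G}\<^sup>*)"

text \<open>A cycle is given by the list of its (at least three) distinct vertices in cyclic order.\<close>

definition is_cycle :: "'a graph \<Rightarrow> 'a list \<Rightarrow> bool" where
  "is_cycle G xs \<longleftrightarrow> 3 \<le> length xs \<and> distinct xs \<and>
     (\<forall>i. Suc i < length xs \<longrightarrow> {xs ! i, xs ! Suc i} \<in> edges G) \<and> {last xs, hd xs} \<in> edges G"

definition tree :: "'a graph \<Rightarrow> bool" where
  "tree G \<longleftrightarrow> simple_graph G \<and> connected_graph G \<and> (\<nexists>xs. is_cycle G xs)"

definition is_path :: "nat \<Rightarrow> 'a graph \<Rightarrow> bool" where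
  "is_path n G \<longleftrightarrow> (\<exists>xs. length xs = n \<and> distinct xs \<and>
     G = (set xs, {{xs ! i, xs ! Suc i} | i. Suc i < n}))"

definition leaf :: "'a graph \<Rightarrow> 'a \<Rightarrow> bool" where
  "leaf G v \<longleftrightarrow> v \<in> verts G \<and> card (nbrs G v) = 1"

definition support_vertex :: "'a graph \<Rightarrow> 'a \<Rightarrow> bool" where
  "support_vertex G v \<longleftrightarrow> v \<in> verts G \<and> (\<exists>u\<in>nbrs G v. leaf G u)"

definition vertex_cover :: "'a graph \<Rightarrow> 'a set \<Rightarrow> bool" where
  "vertex_cover G X \<longleftrightarrow> X \<subseteq> verts G \<and> (\<forall>e\<in>edges G. e \<inter> X \<noteq> {})"

definition tau :: "'a graph \<Rightarrow> nat" where
  "tau G = (LEAST k. \<exists>X. vertex_cover G X \<and> card X = k)"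

definition tau_set :: "'a graph \<Rightarrow> 'a set \<Rightarrow> bool" where
  "tau_set G X \<longleftrightarrow> vertex_cover G X \<and> card X = tau G"

definition dominating_set :: "'a graph \<Rightarrow> 'a set \<Rightarrow> bool" where
  "dominating_set G D \<longleftrightarrow> D \<subseteq> verts G \<and> (\<forall>v\<in>verts G - D. nbrs G v \<inter> D \<noteq> {})"

text \<open>The last conjunct says that the subgraph induced by \<open>D\<close> has no isolated vertices.\<close>

definition total_dominating_set :: "'a graph \<Rightarrow> 'a set \<Rightarrow> bool" where
  "total_dominating_set G D \<longleftrightarrow> dominating_set G D \<and> (\<forall>v\<in>D. nbrs G v \<inter> D \<noteq> {})"

text \<open>The number \<open>gamma_t G\<close> is meaningful only if \<open>G\<close> has no isolated vertices; otherwise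
  \<open>G\<close> has no total dominating set, and \<open>gamma_t_set G\<close> holds of no set.\<close>

definition gamma_t :: "'a graph \<Rightarrow> nat" where
  "gamma_t G = (LEAST k. \<exists>D. total_dominating_set G D \<and> card D = k)"

definition gamma_t_set :: "'a graph \<Rightarrow> 'a set \<Rightarrow> bool" where
  "gamma_t_set G D \<longleftrightarrow> total_dominating_set G D \<and> card D = gamma_t G"

definition gamma_t_tau_set :: "'a graph \<Rightarrow> 'a set \<Rightarrow> bool" where
  "gamma_t_tau_set G S \<longleftrightarrow> gamma_t_set G S \<and> tau_set G S"

definition pn :: "'a graph \<Rightarrow> 'a \<Rightarrow> 'a set \<Rightarrow> 'a set" where
  "pn G v S = {u \<in> verts G. nbrs G u \<inter> S = {v}}"

definition S_quasi_isolated :: "'a graph \<Rightarrow> 'a set \<Rightarrow> 'a \<Rightarrow> bool" where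
  "S_quasi_isolated G S v \<longleftrightarrow> (\<exists>u\<in>S. pn G u S = {v})"

definition quasi_isolated :: "'a graph \<Rightarrow> 'a \<Rightarrow> bool" where
  "quasi_isolated G v \<longleftrightarrow> (\<exists>S. gamma_t_set G S \<and> S_quasi_isolated G S v)"

definition graph_sum :: "'a graph \<Rightarrow> 'a \<Rightarrow> 'a \<Rightarrow> 'a graph \<Rightarrow> 'a graph" where
  "graph_sum G u v H = (verts G \<union> verts H, edges G \<union> edges H \<union> {{u, v}})"

definition op1 :: "'a graph \<Rightarrow> 'a graph \<Rightarrow> bool" where
  "op1 T T' \<longleftrightarrow> (\<exists>u v P. u \<in> verts T \<and> (\<exists>S. gamma_t_tau_set T S \<and> u \<in> S) \<and>
     is_path 4 P \<and> verts T \<inter> verts P = {} \<and> leaf P v \<and> T' = graph_sum T u v P)"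

definition op2 :: "'a graph \<Rightarrow> 'a graph \<Rightarrow> bool" where
  "op2 T T' \<longleftrightarrow> (\<exists>u v. u \<in> verts T \<and> (\<exists>S. gamma_t_tau_set T S \<and> u \<in> S) \<and>
     v \<notin> verts T \<and> T' = (insert v (verts T), insert {u, v} (edges T)))"

definition op3 :: "'a graph \<Rightarrow> 'a graph \<Rightarrow> bool" where
  "op3 T T' \<longleftrightarrow> (\<exists>u v P. u \<in> verts T \<and> (\<exists>S. gamma_t_tau_set T S \<and> u \<in> S) \<and>
     \<not> quasi_isolated T u \<and>
     is_path 2 P \<and> verts T \<inter> verts P = {} \<and> v \<in> verts P \<and> T' = graph_sum T u v P)"

definition op4 :: "'a graph \<Rightarrow> 'a graph \<Rightarrow> bool" where
  "op4 T T' \<longleftrightarrow> (\<exists>u v P. u \<in> verts T \<and> \<not> quasi_isolated T u \<and>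
     is_path 4 P \<and> verts T \<inter> verts P = {} \<and> support_vertex P v \<and> T' = graph_sum T u v P)"

text \<open>The family is closed under isomorphism within the vertex type, because the initial path
  and the attached vertices are arbitrary. Working inside a single vertex type loses nothing,
  since every intermediate tree is a subgraph of the final one.\<close>

inductive_set family_T :: "'a graph set" where
  P4: "is_path 4 T \<Longrightarrow> T \<in> family_T"
| step: "\<lbrakk>T \<in> family_T; tree T'; op1 T T' \<or> op2 T T' \<or> op3 T T' \<or> op4 T T'\<rbrakk> \<Longrightarrow> T' \<in> family_T"

end

theory Submission
  imports Defs
begin

text \<open>Let \<open>S\<close> be a \<open>(\<gamma>\<^sub>t-\<tau>)\<close>-set of \<open>T\<close>. Minimality as a vertex cover gives every
  \<open>x \<in> S\<close> a neighbour outside \<open>S\<close>, so no leaf is in \<open>S\<close>. If two leaves share a neighbour, one of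
  them can be removed (\<open>op2\<close>). Otherwise take a longest path \<open>a, b, c, d, \<dots>\<close>. Then \<open>b\<close> has degree 2
  and \<open>c \<in> S\<close>. If \<open>c\<close> has a neighbour besides \<open>b\<close> and \<open>d\<close>, then \<open>{a, b}\<close> can be removed (\<open>op3\<close>),
  except when \<open>d \<notin> S\<close> and \<open>c\<close> has exactly one further neighbour \<open>x\<close>, a leaf; then \<open>{a, b, c, x}\<close>
  can be removed (\<open>op4\<close>). If \<open>c\<close> has degree 2, then \<open>d \<notin> S\<close>, and
  a second branch of \<open>d\<close> would have the same shape, with \<open>y \<in> S\<close> next to \<open>d\<close>, so
  that replacing \<open>c\<close> and \<open>y\<close> by \<open>d\<close> in \<open>S\<close> would give a smaller vertex cover. Hence \<open>d\<close> has degree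
  at most 2, and either \<open>T = P\<^sub>4\<close> or \<open>{a, b, c, d}\<close> can be removed (\<open>op1\<close>). In all cases the part
  of \<open>S\<close> that remains is a \<open>(\<gamma>\<^sub>t-\<tau>)\<close>-set.\<close>

section \<open>Neighbourhoods and minimality of dominating sets and covers\<close>

lemma nbrs_sym: "u \<in> nbrs G v \<longleftrightarrow> v \<in> nbrs G u"
  by (simp add: nbrs_def insert_commute)

lemma nbrs_symD: "u \<in> nbrs G v \<Longrightarrow> v \<in> nbrs G u"
  by (simp add: nbrs_sym)

lemma edge_iff: "{u, v} \<in> edges G \<longleftrightarrow> v \<in> nbrs G u"
  by (simp add: nbrs_def)

lemma nbrs_in_verts:
  assumes "simple_graph G" "u \<in> nbrs G v"
  shows "u \<in> verts G" "v \<in> verts G" "u \<noteq> v"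
  using assms by (auto simp: simple_graph_def nbrs_def doubleton_eq_iff dest!: subsetD)

lemma simple_graph_edgeE:
  assumes "simple_graph G" "e \<in> edges G"
  obtains x y where "e = {x, y}" "x \<in> verts G" "y \<in> verts G" "x \<noteq> y" "y \<in> nbrs G x"
  using assms unfolding simple_graph_def nbrs_def by blast

lemma total_dominating_set_iff:
  "total_dominating_set G D \<longleftrightarrow> D \<subseteq> verts G \<and> (\<forall>v\<in>verts G. nbrs G v \<inter> D \<noteq> {})"
  unfolding total_dominating_set_def dominating_set_def by blast

lemma vertex_cover_iff:
  assumes "simple_graph G"
  shows "vertex_cover G X \<longleftrightarrow> X \<subseteq> verts G \<and> (\<forall>x y. y \<in> nbrs G x \<longrightarrow> x \<in> X \<or> y \<in> X)"
proof
  assume "vertex_cover G X"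
  then show "X \<subseteq> verts G \<and> (\<forall>x y. y \<in> nbrs G x \<longrightarrow> x \<in> X \<or> y \<in> X)"
    by (fastforce simp: vertex_cover_def nbrs_def)
next
  assume "X \<subseteq> verts G \<and> (\<forall>x y. y \<in> nbrs G x \<longrightarrow> x \<in> X \<or> y \<in> X)"
  then show "vertex_cover G X"
    unfolding vertex_cover_def using simple_graph_edgeE[OF assms] by (metis disjoint_iff insertCI)
qed

text \<open>\<open>gamma_t\<close> and \<open>tau\<close> are both least cardinalities of sets with
  a property, so this one fact turns each into minimality among all such sets.\<close>

lemma Least_card_eq_iff:
  assumes "P X"
  shows "card X = (LEAST k. \<exists>Y. P Y \<and> card Y = k) \<longleftrightarrow> (\<forall>Y. P Y \<longrightarrow> card X \<le> card Y)"
proof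
  assume "card X = (LEAST k. \<exists>Y. P Y \<and> card Y = k)"
  then show "\<forall>Y. P Y \<longrightarrow> card X \<le> card Y" by (auto intro: Least_le)
next
  assume "\<forall>Y. P Y \<longrightarrow> card X \<le> card Y"
  with assms show "card X = (LEAST k. \<exists>Y. P Y \<and> card Y = k)"
    by (intro Least_equality[symmetric]) auto
qed

lemma gamma_t_set_iff:
  "gamma_t_set G D \<longleftrightarrow> total_dominating_set G D \<and>
     (\<forall>D'. total_dominating_set G D' \<longrightarrow> card D \<le> card D')"
  unfolding gamma_t_set_def gamma_t_def using Least_card_eq_iff by blast

lemma tau_set_iff:
  "tau_set G X \<longleftrightarrow> vertex_cover G X \<and> (\<forall>X'. vertex_cover G X' \<longrightarrow> card X \<le> card X')"
  unfolding tau_set_def tau_def using Least_card_eq_iff by blast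

section \<open>Pendant subgraphs\<close>

text \<open>Common frame of the four operations: \<open>T\<close> is the enlarged tree,
  \<open>P\<close> the part attached by the edge \<open>uv\<close>, and \<open>R\<close> below the
  tree before the operation.\<close>

locale pendant =
  fixes T P :: "'a graph" and u v :: 'a
  assumes tree: "tree T"
    and u: "u \<in> verts T" "u \<notin> verts P"
    and v: "v \<in> verts P"
    and verts_P: "verts P \<subseteq> verts T"
    and edges_P: "edges P \<subseteq> edges T" "\<And>e. e \<in> edges P \<Longrightarrow> e \<subseteq> verts P"
    and uv: "{u, v} \<in> edges T"
    and nbrs_P: "\<And>x y. x \<in> verts P \<Longrightarrow> y \<in> nbrs T x \<Longrightarrow> {x, y} \<in> insert {u, v} (edges P)"
begin

definition R :: "'a graph" where
  "R = (verts T - verts P, {e \<in> edges T. e \<inter> verts P = {}})"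

lemma simple: "simple_graph T"
  using tree by (simp add: tree_def)

lemma finite_subset_verts: "X \<subseteq> verts T \<Longrightarrow> finite X"
  using simple by (auto simp: simple_graph_def intro: finite_subset)

lemma verts_R [simp]: "verts R = verts T - verts P"
  by (simp add: R_def)

lemma disjoint: "verts R \<inter> verts P = {}"
  by auto

lemma nbrs_R: "x \<notin> verts P \<Longrightarrow> nbrs R x = nbrs T x - verts P"
  by (auto simp: R_def nbrs_def)

lemma card_R: "card (verts R) < card (verts T)"
  using v verts_P by (intro psubset_card_mono finite_subset_verts) auto

lemma graph_sum_R: "T = graph_sum R u v P"
proof (rule prod_eqI)
  show "verts T = verts (graph_sum R u v P)"
    using verts_P by (auto simp: graph_sum_def)
  have "e \<in> edges R \<union> edges P \<union> {{u, v}}" if e: "e \<in> edges T" for e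
  proof -
    obtain x y where xy: "e = {x, y}" "y \<in> nbrs T x"
      by (rule simple_graph_edgeE[OF simple e])
    then have "{x, y} \<in> insert {u, v} (edges P)" if "x \<in> verts P \<or> y \<in> verts P"
      using that nbrs_P[of x y] nbrs_P[of y x] by (auto simp: nbrs_sym[of x] insert_commute)
    then show ?thesis using e xy(1) by (auto simp: R_def)
  qed
  then show "edges T = edges (graph_sum R u v P)"
    using edges_P(1) uv by (auto simp: graph_sum_def R_def)
qed

lemma attached: "x \<in> verts P \<Longrightarrow> y \<in> nbrs T x \<Longrightarrow> y \<notin> verts P \<Longrightarrow> y = u"
  using nbrs_P[of x y] edges_P(2)[of "{x, y}"] v by (auto simp: doubleton_eq_iff)

text \<open>Collapsing the pendant part to \<open>u\<close> maps walks of \<open>T\<close> to walks of \<open>R\<close>.\<close>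

lemma tree_R: "tree R"
proof -
  define f where "f z = (if z \<in> verts P then u else z)" for z
  let ?ER = "{(x, y). {x, y} \<in> edges R}"
  have "simple_graph R"
    unfolding simple_graph_def
  proof
    show "finite (verts R)" by (rule finite_subset_verts) simp
    show "edges R \<subseteq> {{u, v} |u v. u \<in> verts R \<and> v \<in> verts R \<and> u \<noteq> v}"
    proof
      fix e assume e: "e \<in> edges R"
      then have "e \<in> edges T" by (simp add: R_def)
      then obtain x y where "e = {x, y}" "x \<in> verts T" "y \<in> verts T" "x \<noteq> y"
        by (rule simple_graph_edgeE[OF simple])
      with e show "e \<in> {{u, v} |u v. u \<in> verts R \<and> v \<in> verts R \<and> u \<noteq> v}"
        by (auto simp: R_def)
    qed
  qed
  moreover have "\<nexists>xs. is_cycle R xs"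
    using tree unfolding tree_def is_cycle_def by (auto simp: R_def)
  moreover have walk: "(f x, f y) \<in> ?ER\<^sup>*" if "(x, y) \<in> {(x, y). {x, y} \<in> edges T}\<^sup>*" for x y
    using that
  proof induction
    case (step y z)
    then have yz: "z \<in> nbrs T y" "y \<in> nbrs T z" by (auto simp: nbrs_def insert_commute)
    \<comment> \<open>An edge leaving \<open>P\<close> ends in \<open>u\<close>, so collapsing
      identifies its ends; an edge inside \<open>P\<close> collapses too, and all others survive in
      \<open>R\<close>.\<close>
    have "f y = f z \<or> (f y, f z) \<in> ?ER"
      using attached yz step.hyps(2) by (auto simp: f_def R_def)
    then show ?case using step.IH rtrancl_into_rtrancl[OF step.IH, of "f z"] by auto
  qed simp
  have "(x, y) \<in> ?ER\<^sup>*" if xy: "x \<in> verts R" "y \<in> verts R" for x y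
  proof -
    have "(x, y) \<in> {(x, y). {x, y} \<in> edges T}\<^sup>*"
      using tree xy unfolding tree_def connected_graph_def by simp
    from walk[OF this] show ?thesis using xy by (simp add: f_def)
  qed
  then have "connected_graph R"
    using u unfolding connected_graph_def by auto
  ultimately show ?thesis by (simp add: tree_def)
qed

text \<open>\<open>D\<close> need not be total dominating in \<open>R\<close>: a vertex that it
  misses may be left to \<open>K\<close>. The quasi-isolation argument uses this with one vertex
  taken out of \<open>D\<close>.\<close>

lemma extend_total_dominating_set:
  assumes "\<And>x. x \<in> verts R \<Longrightarrow> nbrs R x \<inter> D \<noteq> {} \<or> nbrs T x \<inter> K \<noteq> {}"
    and "D \<subseteq> verts R" "K \<subseteq> verts T" "\<And>x. x \<in> verts P \<Longrightarrow> nbrs T x \<inter> (D \<union> K) \<noteq> {}"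
  shows "total_dominating_set T (D \<union> K)"
  unfolding total_dominating_set_iff
proof (intro conjI ballI)
  show "D \<union> K \<subseteq> verts T" using assms by auto
  show "nbrs T x \<inter> (D \<union> K) \<noteq> {}" if "x \<in> verts T" for x
    using assms(1)[of x] assms(4)[of x] that nbrs_R[of x] by (cases "x \<in> verts P") auto
qed

lemma extend_vertex_cover:
  assumes "vertex_cover R X" "K \<subseteq> verts T"
    and "\<And>x y. x \<in> verts P \<Longrightarrow> y \<in> nbrs T x \<Longrightarrow> x \<in> K \<or> y \<in> K"
  shows "vertex_cover T (X \<union> K)"
proof -
  have R: "simple_graph R" using tree_R by (simp add: tree_def)
  have "x \<in> X \<union> K \<or> y \<in> X \<union> K" if "y \<in> nbrs T x" for x y
  proof (cases "x \<in> verts P \<or> y \<in> verts P")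
    case True
    then show ?thesis using assms(3) that nbrs_sym by (metis UnI2)
  next
    case False
    then have "y \<in> nbrs R x" using that nbrs_R by auto
    then show ?thesis using assms(1) by (auto simp: vertex_cover_iff[OF R])
  qed
  then show ?thesis
    using assms(1,2) by (auto simp: vertex_cover_iff[OF R] vertex_cover_iff[OF simple])
qed

lemma extend_total_dominating_set_card:
  assumes "total_dominating_set R D" "K \<subseteq> verts T" "card K \<le> k"
    and "\<And>x. x \<in> verts P \<Longrightarrow> nbrs T x \<inter> (D \<union> K) \<noteq> {}"
  shows "\<exists>D'. total_dominating_set T D' \<and> card D' \<le> card D + k"
proof (intro exI conjI)
  show "total_dominating_set T (D \<union> K)"
    using assms by (intro extend_total_dominating_set) (auto simp: total_dominating_set_iff)
  show "card (D \<union> K) \<le> card D + k" using card_Un_le[of D K] assms(3) by linarith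
qed

lemma extend_vertex_cover_card:
  assumes "vertex_cover R X" "K \<subseteq> verts T" "card K \<le> k"
    and "\<And>x y. x \<in> verts P \<Longrightarrow> y \<in> nbrs T x \<Longrightarrow> x \<in> K \<or> y \<in> K"
  shows "\<exists>X'. vertex_cover T X' \<and> card X' \<le> card X + k"
proof (intro exI conjI)
  show "vertex_cover T (X \<union> K)" using assms by (intro extend_vertex_cover)
  show "card (X \<union> K) \<le> card X + k" using card_Un_le[of X K] assms(3) by linarith
qed

section \<open>Restricting an optimal set of \<open>T\<close> to \<open>R\<close>\<close>

context
  fixes S :: "'a set" and k :: nat
  assumes S: "gamma_t_tau_set T S"
    and S_dom: "\<And>x. x \<in> verts R \<Longrightarrow> nbrs T x \<inter> S - verts P \<noteq> {}"
    and S_card: "card (S \<inter> verts P) = k"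
    and ext_dom: "\<And>D. total_dominating_set R D \<Longrightarrow>
      \<exists>D'. total_dominating_set T D' \<and> card D' \<le> card D + k"
    and ext_cover: "\<And>X. vertex_cover R X \<Longrightarrow>
      \<exists>X'. vertex_cover T X' \<and> card X' \<le> card X + k"
begin

lemma card_S: "card S = card (S - verts P) + k"
proof -
  have "finite S"
    using S by (intro finite_subset_verts) (auto simp: gamma_t_tau_set_def tau_set_def vertex_cover_def)
  then show ?thesis using S_card by (metis card_Int_Diff add.commute)
qed

lemma S_R: "total_dominating_set R (S - verts P)" "vertex_cover R (S - verts P)"
proof -
  show "total_dominating_set R (S - verts P)"
    using S S_dom by (fastforce simp: gamma_t_tau_set_def gamma_t_set_def total_dominating_set_iff nbrs_R)
  show "vertex_cover R (S - verts P)"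
    using S by (auto simp: gamma_t_tau_set_def tau_set_def vertex_cover_def R_def)
qed

text \<open>\<open>ext_dom\<close> and \<open>ext_cover\<close> bound both optima of
  \<open>T\<close> by those of \<open>R\<close> plus \<open>k\<close>. As \<open>S\<close> has
  exactly \<open>k\<close> vertices in \<open>P\<close>, a competitor in \<open>R\<close> smaller
  than \<open>S - verts P\<close> would extend to one beating \<open>S\<close> in
  \<open>T\<close>.\<close>

lemma gamma_t_tau_set_R: "gamma_t_tau_set R (S - verts P)"
  unfolding gamma_t_tau_set_def gamma_t_set_iff tau_set_iff
proof (intro conjI allI impI)
  show "card (S - verts P) \<le> card D" if D: "total_dominating_set R D" for D
  proof -
    obtain D' where "total_dominating_set T D'" "card D' \<le> card D + k"
      using ext_dom[OF D] by blast
    then show ?thesis using S card_S by (force simp: gamma_t_tau_set_def gamma_t_set_iff)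
  qed
  show "card (S - verts P) \<le> card X" if X: "vertex_cover R X" for X
  proof -
    obtain X' where "vertex_cover T X'" "card X' \<le> card X + k"
      using ext_cover[OF X] by blast
    then show ?thesis using S card_S by (force simp: gamma_t_tau_set_def tau_set_iff)
  qed
qed (use S_R in auto)

text \<open>If \<open>u\<close> were the only private neighbour of \<open>w \<in> D\<close>, then \<open>w\<close> could be dropped in
  \<open>T\<close>, because the pendant part dominates \<open>u\<close> as well.\<close>

lemma not_quasi_isolated_R:
  assumes "\<And>D w. total_dominating_set R D \<Longrightarrow> w \<in> D \<Longrightarrow> pn R w D = {u} \<Longrightarrow>
      \<exists>K. K \<subseteq> verts T \<and> card K \<le> k \<and> nbrs T u \<inter> K \<noteq> {} \<and>
        (\<forall>x\<in>verts P. nbrs T x \<inter> (D - {w} \<union> K) \<noteq> {})"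
  shows "\<not> quasi_isolated R u"
proof
  assume "quasi_isolated R u"
  then obtain D w where D: "gamma_t_set R D" and w: "w \<in> D" "pn R w D = {u}"
    unfolding quasi_isolated_def S_quasi_isolated_def by blast
  from D have tD: "total_dominating_set R D" by (simp add: gamma_t_set_def)
  obtain K where K: "K \<subseteq> verts T" "card K \<le> k" "nbrs T u \<inter> K \<noteq> {}"
      "\<And>x. x \<in> verts P \<Longrightarrow> nbrs T x \<inter> (D - {w} \<union> K) \<noteq> {}"
    using assms[OF tD w] by blast
  have "nbrs R x \<inter> (D - {w}) \<noteq> {} \<or> nbrs T x \<inter> K \<noteq> {}" if "x \<in> verts R" for x
  proof (cases "x = u")
    case False
    \<comment> \<open>\<open>x\<close> is not private to \<open>w\<close>, so some other vertex of
      \<open>D\<close> dominates it; only \<open>u\<close> depends on \<open>K\<close>.\<close>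
    then have "nbrs R x \<inter> D \<noteq> {w}" using w(2) that unfolding pn_def by blast
    then show ?thesis using tD that unfolding total_dominating_set_iff by blast
  qed (use K(3) in simp)
  then have "total_dominating_set T (D - {w} \<union> K)"
    using tD K by (intro extend_total_dominating_set) (auto simp: total_dominating_set_iff)
  then have "card S \<le> card (D - {w} \<union> K)"
    using S by (auto simp: gamma_t_tau_set_def gamma_t_set_iff)
  also have "\<dots> \<le> card (D - {w}) + card K" by (rule card_Un_le)
  also have "\<dots> \<le> card (D - {w}) + k" using K(2) by simp
  finally have "card (S - verts P) \<le> card (D - {w})" using card_S by simp
  moreover have "finite D"
    using tD by (intro finite_subset_verts) (auto simp: total_dominating_set_iff)
  then have "card (D - {w}) < card D" using w(1) by (rule card_Diff1_less)
  moreover have "card D \<le> card (S - verts P)"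
    using D S_R by (simp add: gamma_t_set_iff)
  ultimately show False by simp
qed

end

end

section \<open>Trees that arise from a smaller tree by an operation\<close>

lemma op1I:
  assumes "u \<in> verts T" "gamma_t_tau_set T S" "u \<in> S" "is_path 4 P" "verts T \<inter> verts P = {}"
    "leaf P v" "T' = graph_sum T u v P"
  shows "op1 T T'"
  using assms unfolding op1_def by blast

lemma op3I:
  assumes "u \<in> verts T" "gamma_t_tau_set T S" "u \<in> S" "\<not> quasi_isolated T u" "is_path 2 P"
    "verts T \<inter> verts P = {}" "v \<in> verts P" "T' = graph_sum T u v P"
  shows "op3 T T'"
  using assms unfolding op3_def by blast

lemma op4I:
  assumes "u \<in> verts T" "\<not> quasi_isolated T u" "is_path 4 P" "verts T \<inter> verts P = {}"
    "support_vertex P v" "T' = graph_sum T u v P"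
  shows "op4 T T'"
  using assms unfolding op4_def by blast

text \<open>What induction on the number of vertices consumes; the irreducible trees, shown below to
  be four-vertex paths, form its base case.\<close>

definition reducible :: "'a graph \<Rightarrow> bool" where
  "reducible T \<longleftrightarrow> (\<exists>T' S. tree T' \<and> gamma_t_tau_set T' S \<and> card (verts T') < card (verts T) \<and>
     (op1 T' T \<or> op2 T' T \<or> op3 T' T \<or> op4 T' T))"

section \<open>Longest paths\<close>

definition gpath :: "'a graph \<Rightarrow> 'a list \<Rightarrow> bool" where
  "gpath G xs \<longleftrightarrow> distinct xs \<and> set xs \<subseteq> verts G \<and> successively (\<lambda>x y. y \<in> nbrs G x) xs"

definition longest :: "'a graph \<Rightarrow> 'a list \<Rightarrow> bool" where
  "longest G xs \<longleftrightarrow> gpath G xs \<and> (\<forall>ys. gpath G ys \<longrightarrow> length ys \<le> length xs)"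

lemma gpath_ConsD:
  assumes "gpath G (x # y # zs)"
  shows "gpath G (y # zs)" "y \<in> nbrs G x" "x \<in> nbrs G y" "x \<noteq> y" "x \<notin> set zs"
  using assms nbrs_symD[of y G x] by (auto simp: gpath_def)

lemma longest_gpath: "longest G xs \<Longrightarrow> gpath G xs"
  by (simp add: longest_def)

lemma longest_exists:
  assumes "tree G"
  shows "\<exists>xs. xs \<noteq> [] \<and> longest G xs"
proof -
  obtain x where x: "x \<in> verts G"
    using assms by (auto simp: tree_def connected_graph_def)
  have fin: "finite (verts G)" using assms by (simp add: tree_def simple_graph_def)
  have "length ys \<le> card (verts G)" if "gpath G ys" for ys
    using that fin by (metis card_mono distinct_card gpath_def)
  then have "\<forall>ys. gpath G ys \<longrightarrow> length ys < Suc (card (verts G))" by (simp add: less_Suc_eq_le)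
  moreover have "gpath G [x]" using x by (simp add: gpath_def)
  ultimately obtain xs where "gpath G xs" "\<forall>ys. gpath G ys \<longrightarrow> length ys \<le> length xs"
    using ex_has_greatest_nat[of "gpath G" "[x]" length] by blast
  then have "longest G xs" by (simp add: longest_def)
  moreover have "xs \<noteq> []"
    using \<open>gpath G [x]\<close> \<open>longest G xs\<close> by (fastforce simp: longest_def)
  ultimately show ?thesis by blast
qed

text \<open>A neighbour \<open>w\<close> already on the path would close the initial segment up to
  \<open>w\<close> to a cycle, so in a tree only the step straight back is excluded.\<close>

lemma gpath_Cons:
  assumes "tree G" "gpath G (x # ys)" "w \<in> nbrs G x" "ys \<noteq> [] \<Longrightarrow> w \<noteq> hd ys"
  shows "gpath G (w # x # ys)"
proof -
  have simple: "simple_graph G" using assms(1) by (simp add: tree_def)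
  have "w \<notin> set (x # ys)"
  proof
    assume "w \<in> set (x # ys)"
    then obtain i where i: "i < length (x # ys)" "(x # ys) ! i = w"
      by (meson in_set_conv_nth)
    have "w \<noteq> x" using nbrs_in_verts[OF simple assms(3)] by simp
    then have "i \<noteq> 0" using i by (metis nth_Cons_0)
    moreover have "i \<noteq> 1" using i assms(4) by (auto simp: hd_conv_nth)
    \<comment> \<open>With positions 0 and 1 excluded, the segment of \<open>Suc i\<close> vertices
      reaches the minimum length 3 of a cycle.\<close>
    ultimately have i2: "2 \<le> i" by simp
    let ?c = "take (Suc i) (x # ys)"
    have len: "length ?c = Suc i" using i(1) by simp
    have "last ?c = w"
      using i len by (metis last_conv_nth length_0_conv lessI nat.distinct(1) nth_take diff_Suc_1)
    moreover have "{?c ! j, ?c ! Suc j} \<in> edges G" if "Suc j < length ?c" for j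
      using assms(2) that len i(1)
      by (simp add: gpath_def successively_conv_nth nbrs_def del: take_Suc_Cons)
    moreover have "distinct ?c" using assms(2) unfolding gpath_def by (metis distinct_take)
    ultimately have "is_cycle G ?c"
      using len i2 assms(3) by (simp add: is_cycle_def nbrs_def insert_commute)
    then show False using assms(1) by (auto simp: tree_def)
  qed
  then show ?thesis
    using assms(2,3) nbrs_in_verts[OF simple assms(3)]
    by (auto simp: gpath_def nbrs_sym[of x])
qed

text \<open>Any further neighbour of the end vertex would prolong the path by
  \<open>gpath_Cons\<close>.\<close>

lemma longest_nbrs_hd:
  assumes "tree G" "longest G (x # y # zs)"
  shows "nbrs G x = {y}"
proof -
  have "w = y" if "w \<in> nbrs G x" for w
    using gpath_Cons[OF assms(1) _ that, of "y # zs"] assms(2) by (fastforce simp: longest_def)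
  moreover have "y \<in> nbrs G x" using assms(2) by (simp add: longest_def gpath_def)
  ultimately show ?thesis by blast
qed

lemma longest_rev:
  assumes "longest G xs"
  shows "longest G (rev xs)"
  using assms by (simp add: longest_def gpath_def nbrs_sym)

section \<open>Reductions\<close>

locale gamma_t_tau_tree =
  fixes T :: "'a graph" and S :: "'a set"
  assumes tree: "tree T" and S: "gamma_t_tau_set T S"
begin

lemma simple: "simple_graph T"
  using tree by (simp add: tree_def)

lemma S_verts: "S \<subseteq> verts T"
  using S by (auto simp: gamma_t_tau_set_def tau_set_def vertex_cover_def)

lemma finite_S: "finite S"
  using S_verts simple by (auto simp: simple_graph_def intro: finite_subset)

lemma S_dom: "x \<in> verts T \<Longrightarrow> \<exists>s\<in>S. s \<in> nbrs T x"
  using S by (auto simp: gamma_t_tau_set_def gamma_t_set_def total_dominating_set_iff)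

lemma S_cover: "y \<in> nbrs T x \<Longrightarrow> x \<in> S \<or> y \<in> S"
  using S by (auto simp: gamma_t_tau_set_def tau_set_def vertex_cover_iff[OF simple])

lemma S_min_cover: "vertex_cover T X \<Longrightarrow> card S \<le> card X"
  using S by (auto simp: gamma_t_tau_set_def tau_set_iff)

text \<open>If all neighbours of \<open>x\<close> were in \<open>S\<close>, they would cover every
  edge at \<open>x\<close>, and \<open>S - {x}\<close> would be a smaller vertex cover.\<close>

lemma S_not_isolated_in_S:
  assumes "x \<in> S"
  shows "\<exists>y\<in>nbrs T x. y \<notin> S"
proof (rule ccontr)
  assume "\<not> ?thesis"
  then have "vertex_cover T (S - {x})"
    using S_verts S_cover nbrs_sym unfolding vertex_cover_iff[OF simple]
    by (metis Diff_iff Diff_subset nbrs_in_verts(3)[OF simple] order_trans singletonD)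
  then show False
    using S_min_cover[of "S - {x}"] card_Diff1_less[OF finite_S assms] by simp
qed

lemma leaf_S:
  assumes "nbrs T a = {b}"
  shows "a \<notin> S" "b \<in> S"
proof -
  have "a \<in> verts T" using assms nbrs_in_verts[OF simple, of b a] by simp
  then show "b \<in> S" using S_dom assms by fastforce
  then show "a \<notin> S" using S_not_isolated_in_S assms by fastforce
qed

text \<open>With \<open>a\<close> removed, the remaining leaf \<open>a'\<close> still forces
  \<open>b\<close> into every total dominating set, and a cover can use \<open>b\<close> in place of
  \<open>a'\<close>; so neither optimum changes and \<open>k\<close> is 0.\<close>

lemma reducible_twin_leaves:
  assumes "nbrs T a = {b}" "nbrs T a' = {b}" "a \<noteq> a'"
  shows "reducible T"
proof -
  have ab: "a \<in> verts T" "b \<in> verts T" "a \<noteq> b" "a' \<in> verts T" "a' \<noteq> b"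
    using assms nbrs_in_verts[OF simple, of b a] nbrs_in_verts[OF simple, of b a'] by auto
  have nb: "a \<in> nbrs T b" "a' \<in> nbrs T b" by (rule nbrs_symD, simp add: assms)+
  note inS = leaf_S[OF assms(1)]
  interpret p: pendant T "({a}, {})" b a
    using tree ab assms nb by unfold_locales (auto simp: edge_iff doubleton_eq_iff)
  have b_a': "nbrs p.R a' = {b}" using p.nbrs_R[of a'] assms ab by auto
  let ?P = "({a}, {}) :: 'a graph"
  have dom: "nbrs T z \<inter> S - verts ?P \<noteq> {}" if "z \<in> verts p.R" for z
    using S_dom[of z] that inS by auto
  have card: "card (S \<inter> verts ?P) = 0" using inS by simp
  have ext_dom: "\<exists>D'. total_dominating_set T D' \<and> card D' \<le> card D + 0"
    if D: "total_dominating_set p.R D" for D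
  proof (rule p.extend_total_dominating_set_card[OF D])
    have "b \<in> D" using D b_a' assms(3) ab by (force simp: total_dominating_set_iff)
    then show "nbrs T x \<inter> (D \<union> {}) \<noteq> {}" if "x \<in> verts ?P" for x
      using assms(1) that by simp
  qed auto
  have ext_cover: "\<exists>X'. vertex_cover T X' \<and> card X' \<le> card X + 0" if X: "vertex_cover p.R X" for X
  proof (intro exI conjI)
    have XR: "X \<subseteq> verts T - {a}" "\<And>x y. y \<in> nbrs p.R x \<Longrightarrow> x \<in> X \<or> y \<in> X"
      using X p.tree_R by (auto simp: vertex_cover_iff tree_def)
    \<comment> \<open>The edge between \<open>b\<close> and \<open>a'\<close> puts one of them into
      \<open>X\<close>. Exchanging \<open>a'\<close> for \<open>b\<close> costs nothing and covers
      the edge at \<open>a\<close> as well.\<close>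
    have "x \<in> insert b (X - {a'}) \<or> y \<in> insert b (X - {a'})" if xy: "y \<in> nbrs T x" for x y
    proof (cases "x \<in> {a, a'} \<or> y \<in> {a, a'}")
      case True
      then show ?thesis using xy nbrs_symD[OF xy] assms by auto
    next
      case False
      then have "y \<in> nbrs p.R x" using xy p.nbrs_R[of x] by simp
      then show ?thesis using XR(2) False by blast
    qed
    then show "vertex_cover T (insert b (X - {a'}))"
      using XR(1) ab by (auto simp: vertex_cover_iff[OF simple])
    have fin: "finite X" using XR(1) by (intro p.finite_subset_verts) auto
    have "b \<in> X \<or> a' \<in> X" using XR(2)[of b a'] b_a' by auto
    then show "card (insert b (X - {a'})) \<le> card X + 0"
    proof
      assume "b \<in> X"
      then have "card (insert b (X - {a'})) \<le> card X" by (intro card_mono fin) auto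
      then show ?thesis by simp
    next
      assume "a' \<in> X"
      then show ?thesis using fin card_Suc_Diff1[of X a'] by (simp add: card_insert_if)
    qed
  qed
  have gt: "gamma_t_tau_set p.R (S - verts ?P)"
    by (rule p.gamma_t_tau_set_R[OF S dom card ext_dom ext_cover])
  have "op2 p.R T"
    unfolding op2_def
  proof (intro exI conjI)
    show "gamma_t_tau_set p.R (S - verts ?P)" by (rule gt)
    show "b \<in> S - verts ?P" using inS ab by simp
    show "T = (insert a (verts p.R), insert {b, a} (edges p.R))"
      using p.graph_sum_R by (simp add: graph_sum_def)
  qed (use ab in auto)
  then show ?thesis using gt p.tree_R p.card_R unfolding reducible_def by blast
qed

text \<open>\<open>s\<close> keeps \<open>c\<close> dominated once \<open>b\<close> is gone. The
  branch at \<open>x\<close>, a leaf or a path of two vertices, lets every total dominating set of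
  \<open>R\<close> be changed at no cost into one containing \<open>c\<close>; adding
  \<open>b\<close> then dominates \<open>a\<close>, and \<open>c\<close> dominates
  \<open>b\<close>.\<close>

lemma reducible_pendant_P2:
  assumes a: "nbrs T a = {b}" and b: "nbrs T b = {a, c}" "a \<noteq> c" and c: "c \<in> S"
    and s: "s \<in> nbrs T c" "s \<in> S" "s \<noteq> b"
    and x: "x \<in> nbrs T c" "x \<noteq> b"
    and x_end: "nbrs T x = {c} \<or> (\<exists>y. y \<noteq> c \<and> nbrs T x = {y, c} \<and> nbrs T y = {x})"
  shows "reducible T"
proof -
  have ab: "a \<in> verts T" "b \<in> verts T" "c \<in> verts T" "x \<in> verts T" "a \<noteq> b" "b \<noteq> c" "c \<noteq> x"
    using nbrs_in_verts[OF simple, of b a] nbrs_in_verts[OF simple, of c b]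
      nbrs_in_verts[OF simple, of x c] a b x by auto
  have nb: "b \<in> nbrs T c" by (rule nbrs_symD) (simp add: b)
  have xa: "x \<noteq> a" using nbrs_symD[OF x(1)] a ab(6) by (metis singletonD)
  note inS = leaf_S[OF a]
  let ?P = "({a, b}, {{a, b}})"
  interpret p: pendant T ?P c b
    using tree ab a b nb
    by unfold_locales (auto simp: edge_iff doubleton_eq_iff)
  have R_c: "c \<in> D \<or> (\<exists>y. x \<in> D \<and> y \<in> D \<and> y \<noteq> c \<and> nbrs p.R x = {y, c} \<and> nbrs p.R y = {x})"
    if D: "total_dominating_set p.R D" for D
    using x_end
  proof
    assume "nbrs T x = {c}"
    then have "nbrs p.R x = {c}" using p.nbrs_R[of x] xa x ab b by auto
    then show ?thesis using D xa x ab by (force simp: total_dominating_set_iff)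
  next
    assume "\<exists>y. y \<noteq> c \<and> nbrs T x = {y, c} \<and> nbrs T y = {x}"
    then obtain y where y: "y \<noteq> c" "nbrs T x = {y, c}" "nbrs T y = {x}" by blast
    have yP: "y \<notin> {a, b}" using y a b x by (auto simp: doubleton_eq_iff)
    have yT: "y \<in> verts T" using y nbrs_in_verts[OF simple, of y x] by simp
    have R: "nbrs p.R x = {y, c}" "nbrs p.R y = {x}"
      using p.nbrs_R[of x] p.nbrs_R[of y] y yP x xa b ab by auto
    have "nbrs p.R x \<inter> D \<noteq> {}" "nbrs p.R y \<inter> D \<noteq> {}"
      using D yP yT x xa ab by (auto simp: total_dominating_set_iff)
    then show ?thesis using R y(1) by auto
  qed
  have dom: "nbrs T z \<inter> S - verts ?P \<noteq> {}" if z: "z \<in> verts p.R" for z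
  proof (cases "z = c")
    case True
    have "s \<noteq> a" using s inS by auto
    then show ?thesis using True s by auto
  next
    case False
    obtain t where t: "t \<in> S" "t \<in> nbrs T z" using S_dom[of z] z by auto
    then have "t \<noteq> b" using nbrs_symD[OF t(2)] b z False by auto
    then show ?thesis using t inS by auto
  qed
  have "S \<inter> verts ?P = {b}" using inS by auto
  then have card: "card (S \<inter> verts ?P) = 1" by simp
  have ext_dom: "\<exists>D'. total_dominating_set T D' \<and> card D' \<le> card D + 1"
    if D: "total_dominating_set p.R D" for D
  proof -
    \<comment> \<open>If \<open>c\<close> is missing, exchange \<open>y\<close> for
      \<open>c\<close>: \<open>y\<close> dominates only \<open>x\<close>, and \<open>c\<close> is
      adjacent to \<open>x\<close> too.\<close>
    have "\<exists>D'. total_dominating_set p.R D' \<and> c \<in> D' \<and> card D' \<le> card D"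
    proof (cases "c \<in> D")
      case False
      then obtain y where y: "x \<in> D" "y \<in> D" "y \<noteq> c" "nbrs p.R x = {y, c}" "nbrs p.R y = {x}"
        using R_c[OF D] by blast
      have fin: "finite D"
        using D by (intro p.finite_subset_verts) (auto simp: total_dominating_set_iff)
      have "nbrs p.R z \<inter> insert c (D - {y}) \<noteq> {}" if z: "z \<in> verts p.R" for z
      proof (cases "z = x")
        case False
        then have "y \<notin> nbrs p.R z" using nbrs_symD[of y p.R z] y(5) by auto
        then show ?thesis using D z unfolding total_dominating_set_iff by blast
      qed (use y in simp)
      then have "total_dominating_set p.R (insert c (D - {y}))"
        using D ab b(2) unfolding total_dominating_set_iff by auto
      moreover have "card (insert c (D - {y})) \<le> card D"
        using card_gt_0_iff[of D] y(2) fin False by auto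
      ultimately show ?thesis by blast
    qed (use D in blast)
    then obtain D' where D': "total_dominating_set p.R D'" "c \<in> D'" "card D' \<le> card D" by blast
    obtain D'' where "total_dominating_set T D''" "card D'' \<le> card D' + 1"
      using p.extend_total_dominating_set_card[OF D'(1), of "{b}" 1] D'(2) a b ab by auto
    then show ?thesis using D'(3) by (intro exI[of _ D'']) simp
  qed
  have ext_cover: "\<exists>X'. vertex_cover T X' \<and> card X' \<le> card X + 1" if X: "vertex_cover p.R X" for X
    using p.extend_vertex_cover_card[OF X, of "{b}" 1] a b ab by auto
  note red = S dom card ext_dom ext_cover
  have gt: "gamma_t_tau_set p.R (S - verts ?P)" by (rule p.gamma_t_tau_set_R[OF red])
  have "\<not> quasi_isolated p.R c"
  proof (rule p.not_quasi_isolated_R[OF red])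
    fix D w
    assume D: "total_dominating_set p.R D" and w: "w \<in> D" "pn p.R w D = {c}"
    have cw: "nbrs p.R c \<inter> D = {w}" using w(2) unfolding pn_def by blast
    \<comment> \<open>Otherwise \<open>x\<close> is in \<open>D\<close> and adjacent to
      \<open>c\<close>, hence \<open>x = w\<close>; then \<open>y\<close> is a second private
      neighbour of \<open>w\<close>.\<close>
    have "c \<in> D"
    proof (rule ccontr)
      assume "c \<notin> D"
      then obtain y where y: "x \<in> D" "y \<in> D" "y \<noteq> c" "nbrs p.R x = {y, c}" "nbrs p.R y = {x}"
        using R_c[OF D] by blast
      have "x \<in> nbrs p.R c" by (rule nbrs_symD) (simp add: y(4))
      then have "x = w" using cw y(1) by blast
      then have "y \<in> pn p.R w D"
        using y D by (auto simp: pn_def total_dominating_set_iff)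
      then show False using w(2) y(3) by blast
    qed
    \<comment> \<open>Thus \<open>c\<close> survives the removal of \<open>w\<close> and dominates
      \<open>b\<close>, so \<open>K = {b}\<close> suffices for \<open>a\<close> and
      \<open>c\<close>.\<close>
    moreover have "w \<noteq> c" using cw nbrs_in_verts(3)[of p.R w c] p.tree_R by (auto simp: tree_def)
    ultimately show "\<exists>K. K \<subseteq> verts T \<and> card K \<le> 1 \<and> nbrs T c \<inter> K \<noteq> {} \<and>
        (\<forall>z\<in>verts ?P. nbrs T z \<inter> (D - {w} \<union> K) \<noteq> {})"
      using a b nb ab by (intro exI[of _ "{b}"]) auto
  qed
  moreover have "is_path 2 ?P"
    unfolding is_path_def
    by (intro exI[of _ "[a, b]"]) (use ab in \<open>auto simp: numeral_2_eq_2 less_Suc_eq\<close>)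
  ultimately have "op3 p.R T"
    using c ab b(2) by (intro op3I[OF _ gt _ _ _ p.disjoint _ p.graph_sum_R]) auto
  then show ?thesis using gt p.tree_R p.card_R unfolding reducible_def by blast
qed

lemma is_path_4:
  assumes "distinct [a, b, c, d]"
  shows "is_path 4 ({a, b, c, d}, {{a, b}, {b, c}, {c, d}})"
proof -
  have "Suc i < 4 \<longleftrightarrow> i = 0 \<or> i = 1 \<or> i = 2" for i by auto
  then have "{{[a, b, c, d] ! i, [a, b, c, d] ! Suc i} |i. Suc i < 4} = {{a, b}, {b, c}, {c, d}}"
    by (auto simp: conj_disj_distribL ex_disj_distrib)
  then show ?thesis
    using assms unfolding is_path_def by (intro exI[of _ "[a, b, c, d]"]) simp
qed

text \<open>The path \<open>a, b, c, d\<close> hangs at \<open>e\<close>. Since \<open>d\<close> is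
  not in \<open>S\<close>, no vertex of \<open>R\<close> relies on the path for domination by
  \<open>S\<close>, and covering the edge \<open>de\<close> forces \<open>e\<close> into
  \<open>S\<close>, as \<open>op1\<close> requires.\<close>

lemma reducible_pendant_P4_leaf:
  assumes a: "nbrs T a = {b}" and b: "nbrs T b = {a, c}" "a \<noteq> c"
    and c: "nbrs T c = {b, d}" "b \<noteq> d" and d: "nbrs T d = {c, e}" "c \<noteq> e"
    and S_cde: "c \<in> S" "d \<notin> S"
  shows "reducible T"
proof -
  have V: "a \<in> verts T" "b \<in> verts T" "c \<in> verts T" "d \<in> verts T" "e \<in> verts T"
    "a \<noteq> b" "b \<noteq> c" "c \<noteq> d" "d \<noteq> e"
    using nbrs_in_verts[OF simple, of b a] nbrs_in_verts[OF simple, of c b]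
      nbrs_in_verts[OF simple, of d c] nbrs_in_verts[OF simple, of e d] a b c d by auto
  have nb: "d \<in> nbrs T e" by (rule nbrs_symD) (simp add: d)
  have ne: "a \<noteq> d" "e \<noteq> a" "e \<noteq> b"
    using a d(1) V(7) b(1) c(2) nb V(8) by (metis insertI1 insertE singletonD)+
  note inS = leaf_S[OF a]
  let ?P = "({a, b, c, d}, {{a, b}, {b, c}, {c, d}})"
  interpret p: pendant T ?P e d
    using tree V a b c d ne nb
    by unfold_locales (auto simp: edge_iff doubleton_eq_iff)
  have dom: "nbrs T z \<inter> S - verts ?P \<noteq> {}" if z: "z \<in> verts p.R" for z
  proof -
    obtain t where t: "t \<in> S" "t \<in> nbrs T z" using S_dom[of z] z by auto
    then have "t \<notin> verts ?P" using nbrs_symD[OF t(2)] a b c S_cde(2) z by auto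
    then show ?thesis using t by auto
  qed
  have "S \<inter> verts ?P = {b, c}" using inS S_cde by auto
  then have card: "card (S \<inter> verts ?P) = 2" using V by simp
  have ext_dom: "\<exists>D'. total_dominating_set T D' \<and> card D' \<le> card D + 2"
    if D: "total_dominating_set p.R D" for D
    by (rule p.extend_total_dominating_set_card[OF D, where K = "{b, c}"]) (use a b c d V in auto)
  have ext_cover: "\<exists>X'. vertex_cover T X' \<and> card X' \<le> card X + 2" if X: "vertex_cover p.R X" for X
    \<comment> \<open>\<open>d\<close> replaces \<open>c\<close> here because the edge
      \<open>de\<close> must be covered as well.\<close>
    by (rule p.extend_vertex_cover_card[OF X, where K = "{b, d}"]) (use a b c d V in auto)
  note red = S dom card ext_dom ext_cover
  have gt: "gamma_t_tau_set p.R (S - verts ?P)" by (rule p.gamma_t_tau_set_R[OF red])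
  have "e \<in> S" using S_cover[of e d] d S_cde by simp
  then have "e \<in> S - verts ?P" using ne d V by auto
  moreover have "nbrs ?P d = {c}" using V(6-) ne c(2-) by (auto simp: nbrs_def doubleton_eq_iff)
  then have "leaf ?P d" by (simp add: leaf_def)
  moreover have "is_path 4 ?P" using V(6-) ne b(2) c(2-) by (intro is_path_4) auto
  ultimately have "op1 p.R T"
    using V by (intro op1I[OF _ gt _ _ p.disjoint _ p.graph_sum_R]) auto
  then show ?thesis using gt p.tree_R p.card_R unfolding reducible_def by blast
qed

text \<open>The path \<open>a, b, c, x\<close> hangs at \<open>d\<close> by its support vertex
  \<open>c\<close>, and \<open>{b, c}\<close> serves both for domination and for covering. As
  \<open>d\<close> is not in \<open>S\<close>, its other neighbours are, and they keep
  \<open>d\<close> dominated.\<close>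

lemma reducible_pendant_P4_support:
  assumes a: "nbrs T a = {b}" and b: "nbrs T b = {a, c}" "a \<noteq> c"
    and c: "nbrs T c = {b, x, d}" "b \<noteq> x" "b \<noteq> d" "x \<noteq> d" and x: "nbrs T x = {c}"
    and d: "d \<notin> S" "nbrs T d \<noteq> {c}"
  shows "reducible T"
proof -
  have V: "a \<in> verts T" "b \<in> verts T" "c \<in> verts T" "d \<in> verts T" "x \<in> verts T"
    "a \<noteq> b" "b \<noteq> c" "c \<noteq> d" "c \<noteq> x"
    using nbrs_in_verts[OF simple, of b a] nbrs_in_verts[OF simple, of c b]
      nbrs_in_verts[OF simple, of d c] nbrs_in_verts[OF simple, of x c] a b c by auto
  have nb: "c \<in> nbrs T d" by (rule nbrs_symD) (simp add: c)
  have ne: "a \<noteq> d" "a \<noteq> x" using a c V nb x by auto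
  note inS = leaf_S[OF a] leaf_S[OF x]
  let ?P = "({a, b, c, x}, {{a, b}, {b, c}, {c, x}})"
  interpret p: pendant T ?P d c
    using tree V a b c x ne nb
    by unfold_locales (auto simp: edge_iff doubleton_eq_iff)
  have dom: "nbrs T z \<inter> S - verts ?P \<noteq> {}" if z: "z \<in> verts p.R" for z
  proof (cases "z = d")
    case True
    obtain e where e: "e \<in> nbrs T d" "e \<noteq> c" using d(2) nb by blast
    then have "e \<in> S" using S_cover d(1) by blast
    moreover have "e \<notin> verts ?P" using nbrs_symD[OF e(1)] e(2) a b x c V ne by auto
    ultimately show ?thesis using True e by auto
  next
    case False
    obtain t where t: "t \<in> S" "t \<in> nbrs T z" using S_dom[of z] z by auto
    then have "t \<notin> verts ?P" using nbrs_symD[OF t(2)] a b c x False z by auto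
    then show ?thesis using t by auto
  qed
  have "S \<inter> verts ?P = {b, c}" using inS by auto
  then have card: "card (S \<inter> verts ?P) = 2" using V by simp
  have ext_dom: "\<exists>D'. total_dominating_set T D' \<and> card D' \<le> card D + 2"
    if D: "total_dominating_set p.R D" for D
    by (rule p.extend_total_dominating_set_card[OF D, where K = "{b, c}"]) (use a b c x V in auto)
  have ext_cover: "\<exists>X'. vertex_cover T X' \<and> card X' \<le> card X + 2" if X: "vertex_cover p.R X" for X
    by (rule p.extend_vertex_cover_card[OF X, where K = "{b, c}"]) (use a b c x V in auto)
  note red = S dom card ext_dom ext_cover
  have gt: "gamma_t_tau_set p.R (S - verts ?P)" by (rule p.gamma_t_tau_set_R[OF red])
  have "\<not> quasi_isolated p.R d"
  proof (rule p.not_quasi_isolated_R[OF red])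
    fix D w
    show "\<exists>K. K \<subseteq> verts T \<and> card K \<le> 2 \<and> nbrs T d \<inter> K \<noteq> {} \<and>
        (\<forall>z\<in>verts ?P. nbrs T z \<inter> (D - {w} \<union> K) \<noteq> {})"
      \<comment> \<open>\<open>{b, c}\<close> dominates \<open>d\<close> and the whole path on its
        own, whichever \<open>w\<close> is dropped.\<close>
      using a b c x nb V by (intro exI[of _ "{b, c}"]) auto
  qed
  moreover have "nbrs ?P x = {c}" "x \<in> nbrs ?P c"
    using V(6-) ne c(2-) by (auto simp: nbrs_def doubleton_eq_iff)
  then have "support_vertex ?P c" unfolding support_vertex_def leaf_def by (intro conjI bexI) simp_all
  moreover have "is_path 4 ?P" using V(6-) ne b(2) c(2-) by (intro is_path_4) auto
  ultimately have "op4 p.R T"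
    using V c(2-) ne by (intro op4I[OF _ _ _ p.disjoint _ p.graph_sum_R]) auto
  then show ?thesis using gt p.tree_R p.card_R unfolding reducible_def by blast
qed

end

section \<open>Irreducible trees\<close>

lemma connected_graph_closed_subset:
  assumes "connected_graph G" "x \<in> X" "X \<subseteq> verts G" "\<And>y. y \<in> X \<Longrightarrow> nbrs G y \<subseteq> X"
  shows "verts G = X"
proof -
  have "z \<in> X" if "(x, z) \<in> {(x, y). {x, y} \<in> edges G}\<^sup>*" for z
    using that assms(2) by induction (use assms(4) in \<open>auto simp: edge_iff\<close>)
  then show ?thesis using assms(1-3) unfolding connected_graph_def by blast
qed

locale irreducible_tree = gamma_t_tau_tree +
  assumes irreducible: "\<not> reducible T"
begin

lemma leaf_unique: "nbrs T a = {b} \<Longrightarrow> nbrs T a' = {b} \<Longrightarrow> a = a'"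
  using reducible_twin_leaves irreducible by blast

text \<open>Any neighbour of \<open>b\<close> other than \<open>c\<close> starts a path of the same
  length, so it is a leaf at \<open>b\<close> and equals \<open>a\<close> by
  \<open>leaf_unique\<close>. Some neighbour of \<open>b\<close> is in \<open>S\<close>, and the
  leaf \<open>a\<close> is not, which leaves \<open>c\<close>.\<close>

lemma longest_start:
  assumes "longest T (a # b # c # rs)"
  shows "nbrs T a = {b}" "nbrs T b = {a, c}" "a \<noteq> c" "c \<in> S"
proof -
  note p = gpath_ConsD[OF longest_gpath[OF assms]]
  note q = gpath_ConsD[OF p(1)]
  show a: "nbrs T a = {b}" by (rule longest_nbrs_hd[OF tree assms])
  show "a \<noteq> c" using p(5) by simp
  have "w = a" if w: "w \<in> nbrs T b" "w \<noteq> c" for w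
  proof -
    have "gpath T (w # b # c # rs)" using w by (intro gpath_Cons[OF tree p(1)]) auto
    then have "longest T (w # b # c # rs)" using assms by (simp add: longest_def)
    then show ?thesis using longest_nbrs_hd[OF tree] leaf_unique a by blast
  qed
  then show b: "nbrs T b = {a, c}" using p(3) q(2) by blast
  have "b \<in> verts T" using nbrs_in_verts(2)[OF simple q(2)] .
  then show "c \<in> S" using S_dom[of b] b leaf_S(1)[OF a] by auto
qed

text \<open>A single vertex has no dominator. On two or three vertices, reversing the path shows a
  vertex of \<open>S\<close> to be a leaf, against \<open>leaf_S\<close>.\<close>

lemma longest_shape:
  assumes L: "longest T xs" and "xs \<noteq> []"
  obtains a b c d rs where "xs = a # b # c # d # rs"
proof -
  obtain a ys where xs: "xs = a # ys" using assms(2) by (cases xs) auto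
  have a: "a \<in> verts T" using longest_gpath[OF L] xs by (simp add: gpath_def)
  have "ys \<noteq> []"
  proof
    assume ys: "ys = []"
    obtain s where s: "s \<in> nbrs T a" using S_dom[OF a] by blast
    have "gpath T [s, a]" using longest_gpath[OF L] xs ys s by (intro gpath_Cons[OF tree]) auto
    then show False using L xs ys by (fastforce simp: longest_def)
  qed
  then obtain b zs where ys: "ys = b # zs" by (cases ys) auto
  have na: "nbrs T a = {b}" using longest_nbrs_hd[OF tree] L xs ys by simp
  have "zs \<noteq> []"
  proof
    assume "zs = []"
    then have "longest T [b, a]" using longest_rev[OF L] xs ys by simp
    then show False using longest_nbrs_hd[OF tree] leaf_S na by blast
  qed
  then obtain c us where zs: "zs = c # us" by (cases zs) auto
  have c: "c \<in> S" using longest_start(4) L xs ys zs by simp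
  have "us \<noteq> []"
  proof
    assume "us = []"
    then have "longest T [c, b, a]" using longest_rev[OF L] xs ys zs by simp
    then show False using longest_nbrs_hd[OF tree] leaf_S c by blast
  qed
  then show thesis using that xs ys zs by (cases us) auto
qed

lemma longest_third:
  assumes L: "longest T (a # b # c # d # rs)"
  shows "nbrs T c = {b, d}"
proof (rule ccontr)
  assume "nbrs T c \<noteq> {b, d}"
  note start = longest_start[OF L]
  note p = gpath_ConsD[OF gpath_ConsD(1)[OF longest_gpath[OF L]]]
  note q = gpath_ConsD[OF p(1)]
  have bd: "b \<noteq> d" using p(5) by simp
  have nc: "b \<in> nbrs T c" "d \<in> nbrs T c" by (fact p(3), fact q(2))
  have side: "nbrs T w = {c}" if w: "w \<in> nbrs T c" "w \<noteq> b" "w \<noteq> d" for w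
  proof (rule ccontr)
    assume "nbrs T w \<noteq> {c}"
    then obtain y where y: "y \<in> nbrs T w" "y \<noteq> c" using nbrs_symD[OF w(1)] by blast
    have "gpath T (w # c # d # rs)" using w by (intro gpath_Cons[OF tree p(1)]) auto
    then have "gpath T (y # w # c # d # rs)" using y by (intro gpath_Cons[OF tree, of w]) auto
    then have L': "longest T (y # w # c # d # rs)" using L by (simp add: longest_def)
    note start' = longest_start[OF L']
    have "w \<in> S" using leaf_S(2)[OF start'(1)] .
    \<comment> \<open>\<open>w\<close> plays both roles: the vertex of \<open>S\<close> that
      dominates \<open>c\<close>, and the start of the further branch.\<close>
    then have "reducible T"
      using reducible_pendant_P2[OF start w(1) _ w(2) w(1,2)] start'(1,2) y(2) by blast
    then show False using irreducible by simp
  qed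
  obtain w where w: "w \<in> nbrs T c" "w \<noteq> b" "w \<noteq> d"
    using \<open>nbrs T c \<noteq> {b, d}\<close> nc by blast
  have c: "nbrs T c = {b, w, d}"
    using side leaf_unique[OF side[OF w]] w nc by blast
  have "reducible T"
  proof (cases "d \<in> S")
    case True
    then show ?thesis
      using reducible_pendant_P2[OF start nc(2) _ bd[symmetric] w(1,2)] side[OF w] by blast
  next
    case False
    \<comment> \<open>Otherwise \<open>d\<close> and \<open>w\<close> would be twin leaves at
      \<open>c\<close>.\<close>
    have "nbrs T d \<noteq> {c}" using leaf_unique[OF side[OF w]] w(3) by blast
    then show ?thesis
      using reducible_pendant_P4_support[OF start(1-3) c _ _ _ side[OF w] False] w bd by blast
  qed
  then show False using irreducible by simp
qed

theorem is_path_4_irreducible: "is_path 4 T"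
proof -
  obtain xs where "xs \<noteq> []" "longest T xs" using longest_exists[OF tree] by blast
  then obtain a b c d rs where L: "longest T (a # b # c # d # rs)"
    using longest_shape by metis
  note start = longest_start[OF L] and c = longest_third[OF L]
  note p = gpath_ConsD[OF longest_gpath[OF L]]
  note q = gpath_ConsD[OF p(1)]
  note r = gpath_ConsD[OF q(1)]
  have ne: "a \<noteq> b" "a \<noteq> c" "a \<noteq> d" "b \<noteq> c" "b \<noteq> d" "c \<noteq> d"
    using p(4,5) q(4,5) r(4) by auto
  have b: "b \<in> S" using leaf_S(2)[OF start(1)] .
  \<comment> \<open>\<open>c\<close> needs a neighbour outside \<open>S\<close>, and
    \<open>b\<close> lies in \<open>S\<close>.\<close>
  have d: "d \<notin> S" using S_not_isolated_in_S[OF start(4)] b unfolding c by blast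
  have cd: "c \<in> nbrs T d" using r(3) .
  have fork: "y = c \<or> rs \<noteq> [] \<and> y = hd rs" if y: "y \<in> nbrs T d" for y
  proof (rule ccontr)
    assume ny: "\<not> (y = c \<or> rs \<noteq> [] \<and> y = hd rs)"
    have yd: "y \<noteq> d" using nbrs_in_verts(3)[OF simple y] by simp
    have yS: "y \<in> S" using S_cover[OF y] d by simp
    have yT: "y \<in> verts T" using nbrs_in_verts(1)[OF simple y] .
    obtain z where z: "z \<in> S" "z \<in> nbrs T y" using S_dom[OF yT] by blast
    \<comment> \<open>\<open>z\<close> is in \<open>S\<close>, hence not a leaf, so the branch at
      \<open>y\<close> continues to some \<open>x\<close> and yields another longest path
      \<open>x, z, y, d, ...\<close>.\<close>
    have "nbrs T z \<noteq> {y}" using leaf_S(1) z(1) by blast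
    then obtain x where x: "x \<in> nbrs T z" "x \<noteq> y" using nbrs_symD[OF z(2)] by blast
    have "gpath T (y # d # rs)" using ny y by (intro gpath_Cons[OF tree r(1)]) auto
    then have "gpath T (z # y # d # rs)" using z d by (intro gpath_Cons[OF tree, of y]) auto
    then have "gpath T (x # z # y # d # rs)" using x by (intro gpath_Cons[OF tree, of z]) auto
    then have "longest T (x # z # y # d # rs)" using L by (simp add: longest_def)
    then have ny': "nbrs T y = {z, d}" by (rule longest_third)
    have yb: "y \<noteq> b" using ny' start(2) ne by (metis insertE insertI1 insert_commute singletonD)
    have zc: "z \<noteq> c" using nbrs_symD[OF z(2)] c yb yd by auto
    have zy: "z \<noteq> y" using nbrs_in_verts(3)[OF simple z(2)] by simp
    \<comment> \<open>All neighbours of \<open>c\<close> and \<open>y\<close> are among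
      \<open>b\<close>, \<open>z\<close> and \<open>d\<close>, and \<open>b\<close>,
      \<open>z\<close> stay in the set, so \<open>d\<close> alone replaces both \<open>c\<close> and
      \<open>y\<close>.\<close>
    let ?X = "insert d (S - {c, y})"
    have one: "v \<in> ?X" if "w \<in> {c, y}" "v \<in> nbrs T w" for v w
      using that c ny' b z(1) zc zy yb ne by auto
    have "v \<in> ?X \<or> w \<in> ?X" if vw: "w \<in> nbrs T v" for v w
      using one[of v w] one[OF _ nbrs_symD[OF vw]] vw S_cover[OF vw] by blast
    moreover have "?X \<subseteq> verts T" using S_verts nbrs_in_verts(2)[OF simple y] by auto
    ultimately have "vertex_cover T ?X" by (simp add: vertex_cover_iff[OF simple])
    then have "card S \<le> card ?X" by (rule S_min_cover)
    moreover have "card ?X = Suc (card (S - {c, y}))" using d finite_S by simp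
    moreover have "card (S - {c, y}) = card S - 2"
      using finite_S start(4) yS ny by (subst card_Diff_subset) auto
    \<comment> \<open>This rules out truncation in \<open>card S - 2\<close>.\<close>
    moreover have "card {c, y} \<le> card S" using finite_S start(4) yS by (intro card_mono) auto
    then have "2 \<le> card S" using ny by (auto split: if_splits)
    ultimately show False by linarith
  qed
  have "nbrs T d = {c}"
  proof (rule ccontr)
    assume "nbrs T d \<noteq> {c}"
    then obtain e where e: "e \<in> nbrs T d" "e \<noteq> c" using cd by blast
    \<comment> \<open>By \<open>fork\<close>, every neighbour of \<open>d\<close> besides
      \<open>c\<close> is the next vertex of the path, so \<open>e\<close> is the only one.\<close>
    then have "nbrs T d = {c, e}" using fork cd by blast
    then have "reducible T"
      using reducible_pendant_P4_leaf[OF start(1-3) c ne(5) _ e(2)[symmetric] start(4) d] by blast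
    then show False using irreducible by simp
  qed
  note nbrs = start(1,2) c this
  have "set (a # b # c # d # rs) \<subseteq> verts T" using longest_gpath[OF L] by (simp add: gpath_def)
  then have V: "verts T = {a, b, c, d}"
    using tree nbrs by (intro connected_graph_closed_subset[of T a]) (auto simp: tree_def)
  have "edges T = {{a, b}, {b, c}, {c, d}}"
  proof
    show "{{a, b}, {b, c}, {c, d}} \<subseteq> edges T" by (simp add: edge_iff nbrs)
    show "edges T \<subseteq> {{a, b}, {b, c}, {c, d}}"
    proof
      fix e assume "e \<in> edges T"
      then obtain x y where "e = {x, y}" "x \<in> verts T" "y \<in> nbrs T x"
        by (rule simple_graph_edgeE[OF simple])
      then show "e \<in> {{a, b}, {b, c}, {c, d}}"
        unfolding V using nbrs by (elim insertE) (auto simp: insert_commute)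
    qed
  qed
  then have "T = ({a, b, c, d}, {{a, b}, {b, c}, {c, d}})" using V by (simp add: prod_eq_iff)
  then show ?thesis using is_path_4[of a b c d] ne by simp
qed

end

section \<open>Induction on the number of vertices\<close>

theorem theorem10:
  fixes T :: "'a graph"
  assumes "tree T"
    and "\<exists>S. gamma_t_tau_set T S"
  shows "T \<in> family_T"
  using assms
proof (induction "card (verts T)" arbitrary: T rule: less_induct)
  case less
  then obtain S where S: "gamma_t_tau_set T S" by blast
  interpret gamma_t_tau_tree T S using less.prems(1) S by unfold_locales
  show ?case
  proof (cases "reducible T")
    case True
    then obtain T' where "tree T'" "\<exists>S. gamma_t_tau_set T' S" "card (verts T') < card (verts T)"
      "op1 T' T \<or> op2 T' T \<or> op3 T' T \<or> op4 T' T"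
      unfolding reducible_def by blast
    then show ?thesis using less by (blast intro: family_T.step)
  next
    case False
    then interpret irreducible_tree T S by unfold_locales
    show ?thesis by (rule family_T.P4[OF is_path_4_irreducible])
  qed
qed

end
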